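(* Let $A$ be a $\mathbb{B}$-algebra. A congruence $I$ of $A$ is prime if and only if it is QC and intersection indecomposable.
   Context: A semiring is a commutative semiring with additive identity $0$ and multiplicative identity $1$, with $1\neq 0$ and $a\cdot 0=0$ for all $a$. A $\mathbb{B}$-algebra is a semiring with idempotent addition ($a+a=a$ for all $a$). A congruence of $A$ is an equivalence relation $I\subseteq A\times A$ compatible with addition and multiplication; $A\times A$ is the improper congruence, all other congruences are proper. Elements of $A\times A$ are called pairs, and the product of pairs is always the twisted product $(\alpha_1,\alpha_2)(\beta_1,\beta_2)=(\alpha_1\beta_1+\alpha_2\beta_2,\ \alpha_1\beta_2+\alpha_2\beta_1)$. A congruence $P$ is prime if it is proper and for all pairs $\alpha,\beta$ with $\alpha\beta\in P$ we have $\alpha\in P$ or $\beta\in P$. A $\mathbb{B}$-algebra is cancellative if $ab=ac$ implies $a=0$ or $b=c$. A congruence $I$ is QC (quotient cancellative) if it is proper and $A/I$ is cancellative. A congruence is intersection indecomposable if it is not the intersection of two strictly larger congruences. *)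

theory Defs
  imports "HOL-Algebra.Ring"
begin

text \<open>
  A commutative semiring with \<open>\<one> \<noteq> \<zero>\<close> and idempotent addition. The library locale \<open>semiring\<close>
  already contains the annihilation laws for \<open>\<zero>\<close> but not commutativity of multiplication.
\<close>
locale B_algebra = semiring A + comm_monoid A for A (structure) +
  assumes one_not_zero: "\<one> \<noteq> \<zero>"
    and add_idem: "a \<in> carrier A \<Longrightarrow> a \<oplus> a = a"

definition congruence_on :: "('a, 'm) ring_scheme \<Rightarrow> ('a \<times> 'a) set \<Rightarrow> bool" where
  "congruence_on A I \<longleftrightarrow>
     equiv (carrier A) I \<and>
     (\<forall>a b c d. (a, b) \<in> I \<and> (c, d) \<in> I \<longrightarrow>
        (a \<oplus>\<^bsub>A\<^esub> c, b \<oplus>\<^bsub>A\<^esub> d) \<in> I \<and> (a \<otimes>\<^bsub>A\<^esub> c, b \<otimes>\<^bsub>A\<^esub> d) \<in> I)"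

definition proper_congruence :: "('a, 'm) ring_scheme \<Rightarrow> ('a \<times> 'a) set \<Rightarrow> bool" where
  "proper_congruence A I \<longleftrightarrow> congruence_on A I \<and> I \<noteq> carrier A \<times> carrier A"

definition twisted_prod :: "('a, 'm) ring_scheme \<Rightarrow> 'a \<times> 'a \<Rightarrow> 'a \<times> 'a \<Rightarrow> 'a \<times> 'a" where
  "twisted_prod A \<alpha> \<beta> =
     (fst \<alpha> \<otimes>\<^bsub>A\<^esub> fst \<beta> \<oplus>\<^bsub>A\<^esub> snd \<alpha> \<otimes>\<^bsub>A\<^esub> snd \<beta>,
      fst \<alpha> \<otimes>\<^bsub>A\<^esub> snd \<beta> \<oplus>\<^bsub>A\<^esub> snd \<alpha> \<otimes>\<^bsub>A\<^esub> fst \<beta>)"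

definition prime_congruence :: "('a, 'm) ring_scheme \<Rightarrow> ('a \<times> 'a) set \<Rightarrow> bool" where
  "prime_congruence A P \<longleftrightarrow>
     proper_congruence A P \<and>
     (\<forall>\<alpha> \<in> carrier A \<times> carrier A. \<forall>\<beta> \<in> carrier A \<times> carrier A.
        twisted_prod A \<alpha> \<beta> \<in> P \<longrightarrow> \<alpha> \<in> P \<or> \<beta> \<in> P)"

definition cancellative :: "('a, 'm) ring_scheme \<Rightarrow> bool" where
  "cancellative A \<longleftrightarrow>
     (\<forall>a \<in> carrier A. \<forall>b \<in> carrier A. \<forall>c \<in> carrier A.
        a \<otimes>\<^bsub>A\<^esub> b = a \<otimes>\<^bsub>A\<^esub> c \<longrightarrow> a = \<zero>\<^bsub>A\<^esub> \<or> b = c)"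

text \<open>
  The operations on classes are written as unions over representatives. When \<open>I\<close> is a congruence,
  each union is over identical sets; see \<open>quotient_add\<close> and \<open>quotient_mult\<close> below.
\<close>
definition quotient_semiring :: "('a, 'm) ring_scheme \<Rightarrow> ('a \<times> 'a) set \<Rightarrow> 'a set ring" where
  "quotient_semiring A I =
     \<lparr> carrier = carrier A // I,
       monoid.mult = (\<lambda>X Y. \<Union>x\<in>X. \<Union>y\<in>Y. I `` {x \<otimes>\<^bsub>A\<^esub> y}),
       one = I `` {\<one>\<^bsub>A\<^esub>},
       zero = I `` {\<zero>\<^bsub>A\<^esub>},
       add = (\<lambda>X Y. \<Union>x\<in>X. \<Union>y\<in>Y. I `` {x \<oplus>\<^bsub>A\<^esub> y}) \<rparr>"

definition QC_congruence :: "('a, 'm) ring_scheme \<Rightarrow> ('a \<times> 'a) set \<Rightarrow> bool" where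
  "QC_congruence A I \<longleftrightarrow> proper_congruence A I \<and> cancellative (quotient_semiring A I)"

definition intersection_indecomposable :: "('a, 'm) ring_scheme \<Rightarrow> ('a \<times> 'a) set \<Rightarrow> bool" where
  "intersection_indecomposable A I \<longleftrightarrow>
     \<not> (\<exists>J K. congruence_on A J \<and> congruence_on A K \<and> I \<subset> J \<and> I \<subset> K \<and> I = J \<inter> K)"

lemma quotient_add:
  assumes "congruence_on A I" "a \<in> carrier A" "b \<in> carrier A"
  shows "I `` {a} \<oplus>\<^bsub>quotient_semiring A I\<^esub> I `` {b} = I `` {a \<oplus>\<^bsub>A\<^esub> b}"
proof -
  have e: "equiv (carrier A) I" using assms(1) by (simp add: congruence_on_def)
  have "(\<lambda>x y. I `` {x \<oplus>\<^bsub>A\<^esub> y}) respects2 I"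
    using assms(1) by (intro congruent2I' equiv_class_eq[OF e]) (auto simp: congruence_on_def)
  from UN_equiv_class2[OF e e this assms(2,3)] show ?thesis
    by (simp add: quotient_semiring_def)
qed

lemma quotient_mult:
  assumes "congruence_on A I" "a \<in> carrier A" "b \<in> carrier A"
  shows "I `` {a} \<otimes>\<^bsub>quotient_semiring A I\<^esub> I `` {b} = I `` {a \<otimes>\<^bsub>A\<^esub> b}"
proof -
  have e: "equiv (carrier A) I" using assms(1) by (simp add: congruence_on_def)
  have "(\<lambda>x y. I `` {x \<otimes>\<^bsub>A\<^esub> y}) respects2 I"
    using assms(1) by (intro congruent2I' equiv_class_eq[OF e]) (auto simp: congruence_on_def)
  from UN_equiv_class2[OF e e this assms(2,3)] show ?thesis
    by (simp add: quotient_semiring_def)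
qed

lemma (in B_algebra) quotient_B_algebra:
  assumes "proper_congruence A I"
  shows "B_algebra (quotient_semiring A I)"
proof -
  let ?Q = "quotient_semiring A I"
  have c: "congruence_on A I" and np: "I \<noteq> carrier A \<times> carrier A"
    using assms by (auto simp: proper_congruence_def)
  have e: "equiv (carrier A) I" using c by (simp add: congruence_on_def)
  have car: "carrier ?Q = (\<lambda>a. I `` {a}) ` carrier A"
    by (auto simp: quotient_semiring_def quotient_def)
  have z: "\<zero>\<^bsub>?Q\<^esub> = I `` {\<zero>}" and o: "\<one>\<^bsub>?Q\<^esub> = I `` {\<one>}"
    by (simp_all add: quotient_semiring_def)
  note s = car z o quotient_add[OF c] quotient_mult[OF c]
  have am: "abelian_monoid ?Q"
    by (rule abelian_monoidI) (auto simp: s a_ac)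
  have cm: "comm_monoid ?Q"
    by (rule comm_monoidI) (auto simp: s m_ac)
  have ne: "\<one>\<^bsub>?Q\<^esub> \<noteq> \<zero>\<^bsub>?Q\<^esub>"
  proof
    assume "\<one>\<^bsub>?Q\<^esub> = \<zero>\<^bsub>?Q\<^esub>"
    then have oz: "(\<one>, \<zero>) \<in> I" using e by (simp add: s eq_equiv_class_iff)
    have az: "(a, \<zero>) \<in> I" if a: "a \<in> carrier A" for a
    proof -
      have "(a, a) \<in> I" using e a by (auto simp: equiv_def refl_on_def)
      then have "(a \<otimes> \<one>, a \<otimes> \<zero>) \<in> I" using c oz by (simp add: congruence_on_def)
      then show ?thesis using a by simp
    qed
    have "carrier A \<times> carrier A \<subseteq> I"
    proof (rule subrelI)
      fix a b assume "(a, b) \<in> carrier A \<times> carrier A"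
      then have "(a, \<zero>) \<in> I" "(\<zero>, b) \<in> I"
        using az e by (auto simp: equiv_def dest: symD)
      then show "(a, b) \<in> I" using e by (auto simp: equiv_def dest: transD)
    qed
    moreover have "I \<subseteq> carrier A \<times> carrier A" using e by (simp add: equiv_def)
    ultimately show False using np by blast
  qed
  have sr: "semiring ?Q"
    by (rule semiring.intro[OF am comm_monoid.axioms(1)[OF cm]], unfold_locales)
      (auto simp: s l_distr r_distr)
  have "a \<oplus>\<^bsub>?Q\<^esub> a = a" if "a \<in> carrier ?Q" for a
    using that by (auto simp: car quotient_add[OF c] add_idem)
  with sr cm ne show ?thesis
    by (simp add: B_algebra_def B_algebra_axioms_def)
qed

end

theory Submission
  imports Defs
begin

text \<open>
  A prime congruence is QC because \<open>(a, 0) (b, c) = (a b, a c)\<close>, and it is indecomposable because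
  the twisted product of a pair of \<open>J\<close> and a pair of \<open>K\<close> lies in \<open>J \<inter> K\<close>.

  Conversely, let \<open>I\<close> be QC. For every pair \<open>\<alpha>\<close> the set \<open>Ann \<alpha> = {\<beta>. \<alpha> \<beta> \<in> I}\<close> is then a
  congruence; only transitivity is not immediate, and it follows by cancelling a common factor in
  \<open>A / I\<close>. Cancellation also shows that \<open>\<gamma> \<gamma> \<in> I\<close> forces \<open>\<gamma> \<in> I\<close>. If now \<open>\<alpha> \<beta> \<in> I\<close> with
  \<open>\<alpha>, \<beta> \<notin> I\<close>, put \<open>J = Ann \<alpha>\<close> and let \<open>K\<close> be the intersection of all \<open>Ann \<delta>\<close> with \<open>\<delta> \<in> J\<close>. Then
  \<open>\<beta> \<in> J\<close>, \<open>\<alpha> \<in> K\<close> and \<open>J \<inter> K = I\<close>, so \<open>I\<close> is decomposable.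
\<close>

section \<open>Cancellative idempotent semirings\<close>

context B_algebra
begin

lemma add_left_idem:
  "\<lbrakk>a \<in> carrier A; b \<in> carrier A\<rbrakk> \<Longrightarrow> a \<oplus> (a \<oplus> b) = a \<oplus> b"
  by (metis add.m_assoc add_idem)

lemma add_eq_zeroD:
  assumes "a \<in> carrier A" "b \<in> carrier A" "a \<oplus> b = \<zero>"
  shows "a = \<zero>" "b = \<zero>"
  using assms add_left_idem[of a b] add_left_idem[of b a] by (simp_all add: add.m_comm)

text \<open>Idempotent addition gives an order: \<open>u \<oplus> t = u\<close> means t \<le> u. In
  this reading the lemma is transitivity; \<open>absorb_mult\<close> and \<open>absorb_add\<close>
  are monotonicity of products and the upper bound property of sums.\<close>

lemma absorb:
  assumes "L \<oplus> u = L" "u \<oplus> t = u" "L \<in> carrier A" "u \<in> carrier A" "t \<in> carrier A"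
  shows "L \<oplus> t = L"
  using assms by (metis add.m_assoc)

lemma cancellativeD:
  assumes "cancellative A" "a \<otimes> b = a \<otimes> c"
    and "a \<in> carrier A" "b \<in> carrier A" "c \<in> carrier A"
  shows "a = \<zero> \<or> b = c"
  using assms unfolding cancellative_def by blast

lemma cancellative_mult_eq_zero:
  assumes "cancellative A" "a \<otimes> b = \<zero>" "a \<in> carrier A" "b \<in> carrier A"
  shows "a = \<zero> \<or> b = \<zero>"
  using cancellativeD[OF assms(1), of a b \<zero>] assms by simp

text \<open>Substituting \<open>sq\<close> gives a(a + b) = ab and b(a + b) = ba. Cancelling a and b
  identifies both with a + b.\<close>

lemma cancellative_twisted_square:
  assumes A: "cancellative A" and car: "a \<in> carrier A" "b \<in> carrier A"
    and sq: "a \<otimes> a \<oplus> b \<otimes> b = a \<otimes> b"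
  shows "a = b"
proof -
  have "a = \<zero> \<or> a \<oplus> b = b"
  proof (rule cancellativeD[OF A])
    show "a \<otimes> (a \<oplus> b) = a \<otimes> b"
      unfolding r_distr[OF car car(1)] sq[symmetric] using car by (simp add: add_left_idem)
  qed (use car in simp_all)
  moreover have "b = \<zero> \<or> a \<oplus> b = a"
  proof (rule cancellativeD[OF A])
    have "b \<otimes> (a \<oplus> b) = a \<otimes> b \<oplus> b \<otimes> b" using car by (simp add: r_distr m_comm)
    also have "\<dots> = a \<otimes> b"
      unfolding sq[symmetric] using car by (simp add: a_assoc add_idem)
    finally show "b \<otimes> (a \<oplus> b) = b \<otimes> a" using car by (simp add: m_comm)
  qed (use car in simp_all)
  \<comment> \<open>Zero cannot be cancelled, but if one of a, b is zero then \<open>sq\<close>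
    makes the square of the other zero.\<close>
  moreover have "a = \<zero> \<longleftrightarrow> b = \<zero>"
    using cancellative_mult_eq_zero[OF A, of a a] cancellative_mult_eq_zero[OF A, of b b] car sq
    by auto
  ultimately show ?thesis by auto
qed

lemma absorb_mult:
  assumes "u \<oplus> s = u" "v \<oplus> t = v"
    and "u \<in> carrier A" "s \<in> carrier A" "v \<in> carrier A" "t \<in> carrier A"
  shows "u \<otimes> v \<oplus> s \<otimes> t = u \<otimes> v"
proof -
  \<comment> \<open>One factor is changed at a time: st \<le> sv \<le> uv.\<close>
  have "u \<otimes> v \<oplus> s \<otimes> v = u \<otimes> v" "s \<otimes> v \<oplus> s \<otimes> t = s \<otimes> v"
    using assms by (metis l_distr r_distr)+
  then show ?thesis using assms by (metis absorb m_closed)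
qed

lemma absorb_add:
  assumes "L \<oplus> u = L" "L \<oplus> t = L" "L \<in> carrier A" "u \<in> carrier A" "t \<in> carrier A"
  shows "L \<oplus> (u \<oplus> t) = L"
  using assms by (metis add.m_assoc)

text \<open>
  With the sums multiplied out, the right-hand side has four monomials that are missing on the
  left; the hypotheses bound each of them by monomials on the left.
\<close>
lemma twisted_trans_factor:
  assumes car: "a \<in> carrier A" "b \<in> carrier A" "x \<in> carrier A" "y \<in> carrier A" "z \<in> carrier A"
    and xy: "a \<otimes> x \<oplus> b \<otimes> y = a \<otimes> y \<oplus> b \<otimes> x"
    and yz: "a \<otimes> y \<oplus> b \<otimes> z = a \<otimes> z \<oplus> b \<otimes> y"
  shows "(a \<otimes> x \<oplus> b \<otimes> z) \<otimes> ((a \<oplus> b) \<otimes> (x \<oplus> (y \<oplus> z)))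
       = ((a \<oplus> b) \<otimes> (x \<oplus> z)) \<otimes> ((a \<oplus> b) \<otimes> (x \<oplus> (y \<oplus> z)))"
proof -
  \<comment> \<open>\<open>w\<close> is the common factor expanded into its six monomials. The
    monomials with y are what lets the hypotheses, which relate x and z only through y, take
    effect.\<close>
  define w where
    "w = a \<otimes> x \<oplus> (a \<otimes> y \<oplus> (a \<otimes> z \<oplus> (b \<otimes> x \<oplus> (b \<otimes> y \<oplus> b \<otimes> z))))"
  define L where "L = (a \<otimes> x \<oplus> b \<otimes> z) \<otimes> w"
  have w: "w \<in> carrier A" and L: "L \<in> carrier A" using car by (simp_all add: w_def L_def)
  have w_eq: "(a \<oplus> b) \<otimes> (x \<oplus> (y \<oplus> z)) = w"
    using car by (simp add: w_def l_distr r_distr a_ac)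
  \<comment> \<open>Each side of an equation bounds its own summands, hence so does the other side:
    \<open>xy\<close> yields \<open>1\<close> and \<open>2\<close>, \<open>yz\<close> yields
    \<open>3\<close> and \<open>4\<close>.\<close>
  have 1: "(a \<otimes> x \<oplus> b \<otimes> y) \<oplus> a \<otimes> y = a \<otimes> x \<oplus> b \<otimes> y"
    and 2: "(a \<otimes> x \<oplus> b \<otimes> y) \<oplus> b \<otimes> x = a \<otimes> x \<oplus> b \<otimes> y"
    unfolding xy using car by (simp_all add: a_ac add_idem add_left_idem)
  have 3: "(a \<otimes> y \<oplus> b \<otimes> z) \<oplus> a \<otimes> z = a \<otimes> y \<oplus> b \<otimes> z"
    and 4: "(a \<otimes> y \<oplus> b \<otimes> z) \<oplus> b \<otimes> y = a \<otimes> y \<oplus> b \<otimes> z"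
    unfolding yz using car by (simp_all add: a_ac add_idem add_left_idem)
  have w_ge: "w \<oplus> a \<otimes> x = w" "w \<oplus> a \<otimes> y = w" "w \<oplus> a \<otimes> z = w"
    "w \<oplus> b \<otimes> x = w" "w \<oplus> b \<otimes> y = w" "w \<oplus> b \<otimes> z = w"
    unfolding w_def using car by (simp_all add: a_ac add_idem add_left_idem)
  have ax: "L \<oplus> (a \<otimes> x) \<otimes> t = L" and bz: "L \<oplus> (b \<otimes> z) \<otimes> t = L"
    if "w \<oplus> t = w" "t \<in> carrier A" for t
    unfolding L_def using car w that
    by - (rule absorb_mult; simp add: a_ac add_idem add_left_idem)+
  \<comment> \<open>If t \<le> u + v, then ct \<le> cu + cv, so bounds on cu and cv by
    \<open>L\<close> pass to ct.\<close>
  have bound: "L \<oplus> c \<otimes> t = L"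
    if "u \<oplus> v \<oplus> t = u \<oplus> v" "L \<oplus> c \<otimes> u = L" "L \<oplus> c \<otimes> v = L"
      "c \<in> carrier A" "u \<in> carrier A" "v \<in> carrier A" "t \<in> carrier A" for c u v t
  proof -
    have "c \<otimes> (u \<oplus> v) \<oplus> c \<otimes> t = c \<otimes> (u \<oplus> v)"
      using that by (intro absorb_mult) (simp_all add: add_idem)
    moreover have "L \<oplus> c \<otimes> (u \<oplus> v) = L"
      using that L by (simp add: r_distr absorb_add)
    ultimately show ?thesis using that L by (metis absorb add.m_closed m_closed)
  qed
  \<comment> \<open>Commutativity regroups these products so that ax or bz becomes a factor, for
    instance (az)(by) = (bz)(ay).\<close>
  have zx: "L \<oplus> (a \<otimes> z) \<otimes> (a \<otimes> x) = L" and zx': "L \<oplus> (a \<otimes> z) \<otimes> (b \<otimes> x) = L"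
    and zy': "L \<oplus> (a \<otimes> z) \<otimes> (b \<otimes> y) = L" and zz': "L \<oplus> (a \<otimes> z) \<otimes> (b \<otimes> z) = L"
    using ax[OF w_ge(3)] bz[OF w_ge(1)] bz[OF w_ge(2)] bz[OF w_ge(3)] car
    by (simp_all add: m_ac)
  \<comment> \<open>The order matters: (az)(ay) is bounded first, since the bound on (az)(az) relies
    on it. Likewise (bx)(by) precedes (bx)(bx) below.\<close>
  have zy: "L \<oplus> (a \<otimes> z) \<otimes> (a \<otimes> y) = L"
    by (rule bound[OF 1]) (use zx zy' car in simp_all)
  have zz: "L \<oplus> (a \<otimes> z) \<otimes> (a \<otimes> z) = L"
    by (rule bound[OF 3]) (use zy zz' car in simp_all)
  have xx': "L \<oplus> (b \<otimes> x) \<otimes> (a \<otimes> x) = L" and xy': "L \<oplus> (b \<otimes> x) \<otimes> (a \<otimes> y) = L"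
    and xz': "L \<oplus> (b \<otimes> x) \<otimes> (a \<otimes> z) = L" and xz: "L \<oplus> (b \<otimes> x) \<otimes> (b \<otimes> z) = L"
    using ax[OF w_ge(4)] ax[OF w_ge(5)] ax[OF w_ge(6)] bz[OF w_ge(4)] car
    by (simp_all add: m_ac)
  have xy: "L \<oplus> (b \<otimes> x) \<otimes> (b \<otimes> y) = L"
    by (rule bound[OF 4]) (use xy' xz car in simp_all)
  have xx: "L \<oplus> (b \<otimes> x) \<otimes> (b \<otimes> x) = L"
    by (rule bound[OF 2]) (use xx' xy car in simp_all)
  have "L \<oplus> (a \<otimes> z) \<otimes> w = L"
    unfolding w_def using zx zy zz zx' zy' zz' L car by (simp add: r_distr absorb_add)
  moreover have "L \<oplus> (b \<otimes> x) \<otimes> w = L"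
    unfolding w_def using xx xy xz xx' xy' xz' L car by (simp add: r_distr absorb_add)
  ultimately have "L \<oplus> ((a \<otimes> z) \<otimes> w \<oplus> (b \<otimes> x) \<otimes> w) = L"
    using L w car by (simp add: absorb_add)
  moreover have "((a \<oplus> b) \<otimes> (x \<oplus> z)) \<otimes> w = L \<oplus> ((a \<otimes> z) \<otimes> w \<oplus> (b \<otimes> x) \<otimes> w)"
    unfolding L_def using car w by (simp add: l_distr r_distr a_ac)
  ultimately show ?thesis unfolding w_eq L_def by simp
qed

text \<open>Multiplied by \<open>w\<close>, both sides become (a + b)(x + z)w, so \<open>w\<close>
  can be cancelled unless it is zero.\<close>

lemma cancellative_twisted_trans:
  assumes A: "cancellative A"
    and car: "a \<in> carrier A" "b \<in> carrier A" "x \<in> carrier A" "y \<in> carrier A" "z \<in> carrier A"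
    and xy: "a \<otimes> x \<oplus> b \<otimes> y = a \<otimes> y \<oplus> b \<otimes> x"
    and yz: "a \<otimes> y \<oplus> b \<otimes> z = a \<otimes> z \<oplus> b \<otimes> y"
  shows "a \<otimes> x \<oplus> b \<otimes> z = a \<otimes> z \<oplus> b \<otimes> x"
proof -
  define w where "w = (a \<oplus> b) \<otimes> (x \<oplus> (y \<oplus> z))"
  have w: "w \<in> carrier A" using car by (simp add: w_def)
  have "(a \<otimes> x \<oplus> b \<otimes> z) \<otimes> w = ((a \<oplus> b) \<otimes> (x \<oplus> z)) \<otimes> w"
    unfolding w_def by (rule twisted_trans_factor[OF car xy yz])
  \<comment> \<open>The hypotheses are symmetric under exchanging a and b, while the left-hand side
    turns into the other one.\<close>
  moreover have "(b \<otimes> x \<oplus> a \<otimes> z) \<otimes> w = ((a \<oplus> b) \<otimes> (x \<oplus> z)) \<otimes> w"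
    using twisted_trans_factor[of b a x y z] car xy yz by (simp add: w_def a_comm)
  ultimately have "w \<otimes> (a \<otimes> x \<oplus> b \<otimes> z) = w \<otimes> (a \<otimes> z \<oplus> b \<otimes> x)"
    using car w by (simp add: a_comm m_comm)
  then consider "w = \<zero>" | "a \<otimes> x \<oplus> b \<otimes> z = a \<otimes> z \<oplus> b \<otimes> x"
    using cancellativeD[OF A] car w by (metis add.m_closed m_closed)
  then show ?thesis
  proof cases
    case 1
    \<comment> \<open>There are no zero divisors, and a sum is zero only if its summands are; either
      way both sides of the goal vanish.\<close>
    then have "a \<oplus> b = \<zero> \<or> x \<oplus> (y \<oplus> z) = \<zero>"
      using cancellative_mult_eq_zero[OF A] car unfolding w_def by simp
    then have "(a = \<zero> \<and> b = \<zero>) \<or> (x = \<zero> \<and> z = \<zero>)"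
      using add_eq_zeroD car by (metis add.m_closed)
    then show ?thesis using car by auto
  qed
qed

end

section \<open>Annihilators of pairs\<close>

definition twisted_annihilator ::
    "('a, 'm) ring_scheme \<Rightarrow> ('a \<times> 'a) set \<Rightarrow> 'a \<times> 'a \<Rightarrow> ('a \<times> 'a) set" where
  "twisted_annihilator A I \<alpha> = {\<beta> \<in> carrier A \<times> carrier A. twisted_prod A \<alpha> \<beta> \<in> I}"

section \<open>Elementary rules for congruences\<close>

lemma congruence_on_carrier: "congruence_on A I \<Longrightarrow> I \<subseteq> carrier A \<times> carrier A"
  by (simp add: congruence_on_def equiv_def)

lemma congruence_on_refl: "\<lbrakk>congruence_on A I; a \<in> carrier A\<rbrakk> \<Longrightarrow> (a, a) \<in> I"
  by (meson congruence_on_def equivE refl_onD)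

lemma congruence_on_sym: "\<lbrakk>congruence_on A I; (a, b) \<in> I\<rbrakk> \<Longrightarrow> (b, a) \<in> I"
  by (meson congruence_on_def equivE symD)

lemma congruence_on_trans: "\<lbrakk>congruence_on A I; (a, b) \<in> I; (b, c) \<in> I\<rbrakk> \<Longrightarrow> (a, c) \<in> I"
  by (meson congruence_on_def equivE transD)

lemma congruence_on_add:
  "\<lbrakk>congruence_on A I; (a, b) \<in> I; (c, d) \<in> I\<rbrakk> \<Longrightarrow> (a \<oplus>\<^bsub>A\<^esub> c, b \<oplus>\<^bsub>A\<^esub> d) \<in> I"
  by (simp add: congruence_on_def)

lemma congruence_on_mult:
  "\<lbrakk>congruence_on A I; (a, b) \<in> I; (c, d) \<in> I\<rbrakk> \<Longrightarrow> (a \<otimes>\<^bsub>A\<^esub> c, b \<otimes>\<^bsub>A\<^esub> d) \<in> I"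
  by (simp add: congruence_on_def)

lemma congruence_onI:
  assumes "I \<subseteq> carrier A \<times> carrier A"
    and "\<And>a. a \<in> carrier A \<Longrightarrow> (a, a) \<in> I"
    and "\<And>a b. (a, b) \<in> I \<Longrightarrow> (b, a) \<in> I"
    and "\<And>a b c. \<lbrakk>(a, b) \<in> I; (b, c) \<in> I\<rbrakk> \<Longrightarrow> (a, c) \<in> I"
    and "\<And>a b c d. \<lbrakk>(a, b) \<in> I; (c, d) \<in> I\<rbrakk> \<Longrightarrow> (a \<oplus>\<^bsub>A\<^esub> c, b \<oplus>\<^bsub>A\<^esub> d) \<in> I"
    and "\<And>a b c d. \<lbrakk>(a, b) \<in> I; (c, d) \<in> I\<rbrakk> \<Longrightarrow> (a \<otimes>\<^bsub>A\<^esub> c, b \<otimes>\<^bsub>A\<^esub> d) \<in> I"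
  shows "congruence_on A I"
proof -
  have "equiv (carrier A) I"
    by (intro equivI refl_onI symI transI) (fact assms)+
  then show ?thesis using assms(5,6) by (simp add: congruence_on_def)
qed

text \<open>Intended for the congruence \<open>K\<close> of the decomposition. An empty family would
  have intersection \<open>UNIV\<close>, hence the first assumption.\<close>

lemma congruence_on_Inter:
  assumes "\<F> \<noteq> {}" "\<And>J. J \<in> \<F> \<Longrightarrow> congruence_on A J"
  shows "congruence_on A (\<Inter>\<F>)"
proof (rule congruence_onI)
  show "\<Inter>\<F> \<subseteq> carrier A \<times> carrier A"
    using assms congruence_on_carrier by blast
  fix a b c d
  show "a \<in> carrier A \<Longrightarrow> (a, a) \<in> \<Inter>\<F>"
    using congruence_on_refl[OF assms(2)] by blast
  assume ab: "(a, b) \<in> \<Inter>\<F>"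
  show "(b, a) \<in> \<Inter>\<F>"
    using ab congruence_on_sym[OF assms(2)] by blast
  show "(b, c) \<in> \<Inter>\<F> \<Longrightarrow> (a, c) \<in> \<Inter>\<F>"
    using ab congruence_on_trans[OF assms(2), of _ a b c] by blast
  assume cd: "(c, d) \<in> \<Inter>\<F>"
  show "(a \<oplus>\<^bsub>A\<^esub> c, b \<oplus>\<^bsub>A\<^esub> d) \<in> \<Inter>\<F>"
    using ab cd congruence_on_add[OF assms(2)] by blast
  show "(a \<otimes>\<^bsub>A\<^esub> c, b \<otimes>\<^bsub>A\<^esub> d) \<in> \<Inter>\<F>"
    using ab cd congruence_on_mult[OF assms(2)] by blast
qed

context B_algebra
begin

lemma twisted_prod_comm:
  assumes "\<alpha> \<in> carrier A \<times> carrier A" "\<beta> \<in> carrier A \<times> carrier A"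
  shows "twisted_prod A \<alpha> \<beta> = twisted_prod A \<beta> \<alpha>"
  using assms by (auto simp: twisted_prod_def m_comm a_comm)

text \<open>A congruence acts like an ideal: the product is (ax, ay) + (by, bx), where the second
  summand uses symmetry.\<close>

lemma congruence_twisted_prod:
  assumes I: "congruence_on A I" and "\<alpha> \<in> carrier A \<times> carrier A" "\<beta> \<in> I"
  shows "twisted_prod A \<alpha> \<beta> \<in> I"
proof -
  obtain a b x y where eq: "\<alpha> = (a, b)" "\<beta> = (x, y)" by (metis surj_pair)
  have car: "a \<in> carrier A" "b \<in> carrier A" and xy: "(x, y) \<in> I" using assms eq by auto
  have "(a \<otimes> x, a \<otimes> y) \<in> I" "(b \<otimes> y, b \<otimes> x) \<in> I"
    using congruence_on_mult[OF I congruence_on_refl[OF I]] car xy congruence_on_sym[OF I xy]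
    by blast+
  from congruence_on_add[OF I this] show ?thesis by (simp add: eq twisted_prod_def)
qed

lemma quotient_class_eq:
  assumes "congruence_on A I" "u \<in> carrier A" "v \<in> carrier A"
  shows "I `` {u} = I `` {v} \<longleftrightarrow> (u, v) \<in> I"
  using assms eq_equiv_class_iff[of "carrier A" I u v] by (simp add: congruence_on_def)

lemma quotient_class_closed:
  "a \<in> carrier A \<Longrightarrow> I `` {a} \<in> carrier (quotient_semiring A I)"
  by (auto simp: quotient_semiring_def quotientI)

lemma QC_twisted_square:
  assumes QC: "QC_congruence A I" and \<gamma>: "\<gamma> \<in> carrier A \<times> carrier A" "twisted_prod A \<gamma> \<gamma> \<in> I"
  shows "\<gamma> \<in> I"
proof -
  have p: "proper_congruence A I" and can: "cancellative (quotient_semiring A I)"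
    and I: "congruence_on A I"
    using QC by (auto simp: QC_congruence_def proper_congruence_def)
  interpret Q: B_algebra "quotient_semiring A I" using p by (rule quotient_B_algebra)
  obtain a b where eq: "\<gamma> = (a, b)" by (metis surj_pair)
  have car: "a \<in> carrier A" "b \<in> carrier A" using \<gamma> eq by auto
  note q = quotient_class_eq[OF I] quotient_add[OF I] quotient_mult[OF I]
  \<comment> \<open>Idempotence reduces the second coordinate of \<gamma>\<gamma> to ab, the form
    expected by \<open>cancellative_twisted_square\<close>.\<close>
  have "a \<otimes> b \<oplus> b \<otimes> a = a \<otimes> b" using car by (simp add: m_comm add_idem)
  then have "(a \<otimes> a \<oplus> b \<otimes> b, a \<otimes> b) \<in> I" using \<gamma> eq by (simp add: twisted_prod_def)
  then have "I `` {a} = I `` {b}"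
    using car
    by - (rule Q.cancellative_twisted_square[OF can], simp_all add: q quotient_class_closed)
  then show ?thesis using car by (simp add: q eq)
qed

lemma QC_annihilator_trans:
  assumes QC: "QC_congruence A I" and \<alpha>: "\<alpha> \<in> carrier A \<times> carrier A"
    and xy: "(x, y) \<in> twisted_annihilator A I \<alpha>" and yz: "(y, z) \<in> twisted_annihilator A I \<alpha>"
  shows "(x, z) \<in> twisted_annihilator A I \<alpha>"
proof -
  have p: "proper_congruence A I" and can: "cancellative (quotient_semiring A I)"
    and I: "congruence_on A I"
    using QC by (auto simp: QC_congruence_def proper_congruence_def)
  interpret Q: B_algebra "quotient_semiring A I" using p by (rule quotient_B_algebra)
  obtain a b where eq: "\<alpha> = (a, b)" by (metis surj_pair)
  have car: "a \<in> carrier A" "b \<in> carrier A" "x \<in> carrier A" "y \<in> carrier A" "z \<in> carrier A"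
    using \<alpha> eq xy yz by (auto simp: twisted_annihilator_def)
  let ?\<pi> = "\<lambda>u. I `` {u}" and ?Q = "quotient_semiring A I"
  note q = quotient_class_eq[OF I] quotient_add[OF I] quotient_mult[OF I]
  \<comment> \<open>Membership in the annihilator becomes an equation in A / I, where cancellation
    is available.\<close>
  have iff: "(u, v) \<in> twisted_annihilator A I \<alpha> \<longleftrightarrow>
      ?\<pi> a \<otimes>\<^bsub>?Q\<^esub> ?\<pi> u \<oplus>\<^bsub>?Q\<^esub> ?\<pi> b \<otimes>\<^bsub>?Q\<^esub> ?\<pi> v = ?\<pi> a \<otimes>\<^bsub>?Q\<^esub> ?\<pi> v \<oplus>\<^bsub>?Q\<^esub> ?\<pi> b \<otimes>\<^bsub>?Q\<^esub> ?\<pi> u"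
    if "u \<in> carrier A" "v \<in> carrier A" for u v
    using that car by (simp add: q eq twisted_annihilator_def twisted_prod_def)
  show ?thesis
    using xy yz unfolding iff[OF car(3,4)] iff[OF car(4,5)] iff[OF car(3,5)]
    \<comment> \<open>The rotation puts the two equations before the five carrier premises, so that
      the chained facts match them.\<close>
    by (rule Q.cancellative_twisted_trans[OF can, rotated 5]) (simp_all add: quotient_class_closed car)
qed

lemma QC_annihilator_congruence:
  assumes QC: "QC_congruence A I" and \<alpha>: "\<alpha> \<in> carrier A \<times> carrier A"
  shows "congruence_on A (twisted_annihilator A I \<alpha>)"
proof -
  let ?N = "twisted_annihilator A I \<alpha>"
  have I: "congruence_on A I" using QC by (simp add: QC_congruence_def proper_congruence_def)
  obtain a b where eq: "\<alpha> = (a, b)" by (metis surj_pair)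
  have car: "a \<in> carrier A" "b \<in> carrier A" using \<alpha> eq by auto
  have N: "(x, y) \<in> ?N \<longleftrightarrow> x \<in> carrier A \<and> y \<in> carrier A \<and>
      (a \<otimes> x \<oplus> b \<otimes> y, a \<otimes> y \<oplus> b \<otimes> x) \<in> I" for x y
    by (auto simp: twisted_annihilator_def twisted_prod_def eq)
  have scale: "(c \<otimes> x, c \<otimes> y) \<in> ?N" if c: "c \<in> carrier A" and xy: "(x, y) \<in> ?N" for c x y
  proof -
    have "(c \<otimes> (a \<otimes> x \<oplus> b \<otimes> y), c \<otimes> (a \<otimes> y \<oplus> b \<otimes> x)) \<in> I"
      using congruence_on_mult[OF I congruence_on_refl[OF I c]] xy by (simp add: N)
    then show ?thesis using c xy car by (simp add: N r_distr m_lcomm)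
  qed
  show ?thesis
  proof (rule congruence_onI)
    show "?N \<subseteq> carrier A \<times> carrier A" by (auto simp: N)
  next
    fix x assume "x \<in> carrier A"
    then show "(x, x) \<in> ?N" using I car by (auto simp: N intro: congruence_on_refl)
  next
    fix x y assume "(x, y) \<in> ?N"
    then show "(y, x) \<in> ?N" by (simp add: N congruence_on_sym[OF I])
  next
    fix x y z assume "(x, y) \<in> ?N" "(y, z) \<in> ?N"
    then show "(x, z) \<in> ?N" by (rule QC_annihilator_trans[OF QC \<alpha>])
  next
    fix x y u v assume *: "(x, y) \<in> ?N" "(u, v) \<in> ?N"
    then have "((a \<otimes> x \<oplus> b \<otimes> y) \<oplus> (a \<otimes> u \<oplus> b \<otimes> v),
        (a \<otimes> y \<oplus> b \<otimes> x) \<oplus> (a \<otimes> v \<oplus> b \<otimes> u)) \<in> I"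
      by (auto simp: N intro: congruence_on_add[OF I])
    then show "(x \<oplus> u, y \<oplus> v) \<in> ?N" using * car by (simp add: N r_distr a_ac)
  next
    fix x y u v assume *: "(x, y) \<in> ?N" "(u, v) \<in> ?N"
    then have car': "x \<in> carrier A" "y \<in> carrier A" "u \<in> carrier A" "v \<in> carrier A"
      by (auto simp: N)
    \<comment> \<open>The pairs (xu, yu) and (yu, yv) are scalings; transitivity joins them at
      yu.\<close>
    have "(u \<otimes> x, u \<otimes> y) \<in> ?N" "(y \<otimes> u, y \<otimes> v) \<in> ?N" using * car' scale by auto
    then show "(x \<otimes> u, y \<otimes> v) \<in> ?N"
      using QC_annihilator_trans[OF QC \<alpha>] car' by (metis m_comm)
  qed
qed

section \<open>Prime congruences\<close>

lemma prime_imp_QC: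
  assumes P: "prime_congruence A I"
  shows "QC_congruence A I"
proof -
  let ?Q = "quotient_semiring A I"
  have p: "proper_congruence A I" and I: "congruence_on A I"
    using P by (auto simp: prime_congruence_def proper_congruence_def)
  note q = quotient_class_eq[OF I] quotient_mult[OF I]
  have "I `` {a} = \<zero>\<^bsub>?Q\<^esub> \<or> I `` {b} = I `` {c}"
    if car: "a \<in> carrier A" "b \<in> carrier A" "c \<in> carrier A"
      and eq: "I `` {a} \<otimes>\<^bsub>?Q\<^esub> I `` {b} = I `` {a} \<otimes>\<^bsub>?Q\<^esub> I `` {c}" for a b c
  proof -
    have "twisted_prod A (a, \<zero>) (b, c) \<in> I"
      using car eq by (simp add: q twisted_prod_def)
    then have "(a, \<zero>) \<in> I \<or> (b, c) \<in> I"
      using P car unfolding prime_congruence_def by blast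
    moreover have "\<zero>\<^bsub>?Q\<^esub> = I `` {\<zero>}" by (simp add: quotient_semiring_def)
    ultimately show ?thesis using car by (simp add: q)
  qed
  moreover have "carrier ?Q = (\<lambda>a. I `` {a}) ` carrier A"
    by (auto simp: quotient_semiring_def quotient_def)
  ultimately show ?thesis using p by (auto simp: QC_congruence_def cancellative_def)
qed

lemma prime_imp_indecomposable:
  assumes P: "prime_congruence A I"
  shows "intersection_indecomposable A I"
  unfolding intersection_indecomposable_def
proof (intro notI, elim exE conjE)
  fix J K
  assume J: "congruence_on A J" and K: "congruence_on A K"
    and JK: "I \<subset> J" "I \<subset> K" "I = J \<inter> K"
  obtain \<alpha> \<beta> where \<alpha>: "\<alpha> \<in> J" "\<alpha> \<notin> I" and \<beta>: "\<beta> \<in> K" "\<beta> \<notin> I" using JK by blast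
  have car: "\<alpha> \<in> carrier A \<times> carrier A" "\<beta> \<in> carrier A \<times> carrier A"
    using \<alpha> \<beta> J K congruence_on_carrier by blast+
  have "twisted_prod A \<alpha> \<beta> \<in> K" by (rule congruence_twisted_prod[OF K car(1) \<beta>(1)])
  moreover have "twisted_prod A \<alpha> \<beta> \<in> J"
    \<comment> \<open>The ideal property takes its factor from the congruence on the right, so the
      product is commuted first.\<close>
    using congruence_twisted_prod[OF J car(2) \<alpha>(1)] twisted_prod_comm[OF car] by simp
  ultimately have "twisted_prod A \<alpha> \<beta> \<in> I" using JK by simp
  then show False using P car \<alpha> \<beta> unfolding prime_congruence_def by blast
qed

lemma QC_indecomposable_imp_prime:
  assumes QC: "QC_congruence A I" and ind: "intersection_indecomposable A I"
  shows "prime_congruence A I"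
proof -
  have p: "proper_congruence A I" and I: "congruence_on A I"
    using QC by (auto simp: QC_congruence_def proper_congruence_def)
  note sub = congruence_on_carrier[OF I]
  have "\<alpha> \<in> I \<or> \<beta> \<in> I"
    if car: "\<alpha> \<in> carrier A \<times> carrier A" "\<beta> \<in> carrier A \<times> carrier A"
      and prod: "twisted_prod A \<alpha> \<beta> \<in> I" for \<alpha> \<beta>
  proof (rule ccontr)
    assume neg: "\<not> (\<alpha> \<in> I \<or> \<beta> \<in> I)"
    define J where "J = twisted_annihilator A I \<alpha>"
    \<comment> \<open>\<open>K\<close> is the double annihilator of \<alpha>; \<beta> in
      \<open>J\<close> ensures that the intersected family is nonempty.\<close>
    define K where "K = \<Inter>(twisted_annihilator A I ` J)"
    have J: "congruence_on A J" unfolding J_def by (rule QC_annihilator_congruence[OF QC car(1)])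
    have Jc: "J \<subseteq> carrier A \<times> carrier A" by (rule congruence_on_carrier[OF J])
    have \<beta>J: "\<beta> \<in> J" using car prod by (simp add: J_def twisted_annihilator_def)
    have K: "congruence_on A K" unfolding K_def
      by (rule congruence_on_Inter) (use \<beta>J Jc QC_annihilator_congruence[OF QC] in auto)
    have ann: "I \<subseteq> twisted_annihilator A I \<delta>" if "\<delta> \<in> carrier A \<times> carrier A" for \<delta>
      using that sub congruence_twisted_prod[OF I] by (auto simp: twisted_annihilator_def)
    have IJ: "I \<subseteq> J" unfolding J_def by (rule ann[OF car(1)])
    have IK: "I \<subseteq> K" unfolding K_def using ann Jc by blast
    have \<alpha>K: "\<alpha> \<in> K"
    proof -
      have "\<alpha> \<in> twisted_annihilator A I \<delta>" if "\<delta> \<in> J" for \<delta>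
        using that car(1) twisted_prod_comm[of \<alpha> \<delta>] by (simp add: J_def twisted_annihilator_def)
      then show ?thesis by (simp add: K_def)
    qed
    have "J \<inter> K \<subseteq> I"
    proof
      fix \<gamma> assume \<gamma>: "\<gamma> \<in> J \<inter> K"
      \<comment> \<open>As \<gamma> lies in \<open>J\<close>, its own annihilator is among the sets
        whose intersection is \<open>K\<close>, so \<gamma>\<gamma> lies in
        \<open>I\<close>.\<close>
      then have "\<gamma> \<in> twisted_annihilator A I \<gamma>" by (auto simp: K_def)
      then show "\<gamma> \<in> I" using QC_twisted_square[OF QC] by (simp add: twisted_annihilator_def)
    qed
    \<comment> \<open>Strictness is witnessed by \<beta> for \<open>J\<close> and by \<alpha> for
      \<open>K\<close>.\<close>
    then have "I = J \<inter> K" "I \<subset> J" "I \<subset> K" using IJ IK \<beta>J \<alpha>K neg by auto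
    then show False using ind J K unfolding intersection_indecomposable_def by blast
  qed
  then show ?thesis using p unfolding prime_congruence_def by blast
qed

end

theorem theorem2p13:
  fixes A :: "('a, 'm) ring_scheme" and I :: "('a \<times> 'a) set"
  assumes "B_algebra A" and "congruence_on A I"
  shows "prime_congruence A I \<longleftrightarrow> QC_congruence A I \<and> intersection_indecomposable A I"
  using B_algebra.prime_imp_QC[OF assms(1)] B_algebra.prime_imp_indecomposable[OF assms(1)]
    B_algebra.QC_indecomposable_imp_prime[OF assms(1)] by blast

end
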